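(* For every graph $G$, $$\operatorname{diam}(G)\ \le\ \max\bigl(4\chi_a(G)-7,\,2\bigr)\ \le\ \max\bigl(4\chi_s(G)-7,\,2\bigr).$$
   Context: Graphs are finite and simple. For an oriented graph $\overrightarrow{G}$ and $X\subseteq V(\overrightarrow{G})$, the inversion of $X$ reverses every arc having both endpoints in $X$ (and no other arc). For a (labeled) graph $G$, the inversion distance between two orientations of $G$ is the minimum number of inversions transforming one into the other (equality as labeled oriented graphs), and the inversion diameter $\operatorname{diam}(G)$ is the maximum inversion distance over all pairs of orientations of $G$. The acyclic chromatic number $\chi_a(G)$ (resp. star chromatic number $\chi_s(G)$) is the minimum number of colors in a proper vertex-coloring of $G$ such that the union of any two color classes induces a forest (resp. a star forest, i.e. a forest each of whose components is a star). *)

theory Defs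
  imports "Graph_Theory.Graph_Theory"
begin

text \<open>
  A finite simple graph is a \<^locale>\<open>pair_graph\<close>: a finite loop-free symmetric digraph
  in which every edge \<open>uv\<close> is represented by the two arcs \<open>(u, v)\<close> and \<open>(v, u)\<close>.
\<close>

section \<open>Inversions of orientations\<close>

definition orientation :: "'a pair_pre_digraph \<Rightarrow> 'a pair_pre_digraph \<Rightarrow> bool" where
  "orientation G D \<longleftrightarrow> pverts D = pverts G \<and> parcs D \<subseteq> parcs G \<and>
     (\<forall>(u, v) \<in> parcs G. (u, v) \<in> parcs D \<longleftrightarrow> (v, u) \<notin> parcs D)"

definition invert :: "'a set \<Rightarrow> 'a pair_pre_digraph \<Rightarrow> 'a pair_pre_digraph" where
  "invert X D = \<lparr> pverts = pverts D,
     parcs = (\<lambda>(u, v). if u \<in> X \<and> v \<in> X then (v, u) else (u, v)) ` parcs D \<rparr>"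

definition inversion_distance :: "'a pair_pre_digraph \<Rightarrow> 'a pair_pre_digraph \<Rightarrow> nat" where
  "inversion_distance D D' = (LEAST k. \<exists>Xs. length Xs = k \<and>
     (\<forall>X \<in> set Xs. X \<subseteq> pverts D) \<and> fold invert Xs D = D')"

definition inversion_diameter :: "'a pair_pre_digraph \<Rightarrow> nat" where
  "inversion_diameter G =
     Max {inversion_distance D D' | D D'. orientation G D \<and> orientation G D'}"

section \<open>Forests and star forests\<close>

text \<open>
  The library's \<^const>\<open>forest\<close> excludes all directed cycles, hence also the closed walk
  \<open>u, v, u\<close> that every edge of a symmetric digraph gives rise to. The cycles of the underlying
  undirected graph are the directed cycles of length at least 3.
\<close>

definition undirected_forest :: "('a, 'b) pre_digraph \<Rightarrow> bool" where
  "undirected_forest H \<longleftrightarrow> \<not> (\<exists>p. pre_digraph.cycle H p \<and> 3 \<le> length p)"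

text \<open>A single vertex is a star (with no leaves).\<close>

definition star :: "('a, 'b) pre_digraph \<Rightarrow> bool" where
  "star H \<longleftrightarrow> (\<exists>c \<in> verts H.
     arcs_ends H = {c} \<times> (verts H - {c}) \<union> (verts H - {c}) \<times> {c})"

text \<open>
  In a symmetric digraph the strongly connected components are the connected components of the
  underlying undirected graph.
\<close>

definition star_forest :: "('a, 'b) pre_digraph \<Rightarrow> bool" where
  "star_forest H \<longleftrightarrow> undirected_forest H \<and> (\<forall>C \<in> pre_digraph.sccs H. star C)"

section \<open>Acyclic and star colourings\<close>

definition proper_colouring :: "'a pair_pre_digraph \<Rightarrow> nat \<Rightarrow> ('a \<Rightarrow> nat) \<Rightarrow> bool" where
  "proper_colouring G k f \<longleftrightarrow> f ` pverts G \<subseteq> {..<k} \<and> (\<forall>(u, v) \<in> parcs G. f u \<noteq> f v)"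

definition colour_class :: "'a pair_pre_digraph \<Rightarrow> ('a \<Rightarrow> nat) \<Rightarrow> nat \<Rightarrow> 'a set" where
  "colour_class G f i = {v \<in> pverts G. f v = i}"

definition acyclic_colouring :: "'a pair_pre_digraph \<Rightarrow> nat \<Rightarrow> ('a \<Rightarrow> nat) \<Rightarrow> bool" where
  "acyclic_colouring G k f \<longleftrightarrow> proper_colouring G k f \<and>
     (\<forall>i<k. \<forall>j<k. i \<noteq> j \<longrightarrow>
        undirected_forest (with_proj G \<restriction> (colour_class G f i \<union> colour_class G f j)))"

definition star_colouring :: "'a pair_pre_digraph \<Rightarrow> nat \<Rightarrow> ('a \<Rightarrow> nat) \<Rightarrow> bool" where
  "star_colouring G k f \<longleftrightarrow> proper_colouring G k f \<and>
     (\<forall>i<k. \<forall>j<k. i \<noteq> j \<longrightarrow>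
        star_forest (with_proj G \<restriction> (colour_class G f i \<union> colour_class G f j)))"

definition acyclic_chromatic_number :: "'a pair_pre_digraph \<Rightarrow> nat" where
  "acyclic_chromatic_number G = (LEAST k. \<exists>f. acyclic_colouring G k f)"

definition star_chromatic_number :: "'a pair_pre_digraph \<Rightarrow> nat" where
  "star_chromatic_number G = (LEAST k. \<exists>f. star_colouring G k f)"

end

theory Submission
  imports Defs
begin

text \<open>
  A colour pair of an acyclic \<open>k\<close>-colouring \<open>f\<close> induces a forest, and on a forest every equation system
  \<open>p u + p v = L u v\<close> over the two-element field is solvable. Hence one can give each vertex \<open>v\<close> a
  bit \<open>b v i\<close> for every colour \<open>i\<close> such that \<open>b u (f v) + b v (f u)\<close> is prescribed on all edges.
  The two inversions \<open>{v. f v = i \<or> b v i}\<close> and \<open>{v. f v \<noteq> i \<and> b v i}\<close> together reverse an edge \<open>uv\<close>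
  with \<open>f u = i\<close> exactly if \<open>b v i\<close>, and cancel on edges avoiding colour \<open>i\<close>. For the last
  colour \<open>m\<close> the second inversion is dropped; the resulting error \<open>b u m \<and> b v m\<close> on edges avoiding
  \<open>m\<close> is known once the colour pairs containing \<open>m\<close> have been solved. This uses
  \<open>2k - 1 \<le> 4k - 7\<close> inversions if \<open>k \<ge> 3\<close>; if \<open>k \<le> 2\<close>, no edge avoids both colours and
  two inversions of the first kind suffice.
\<close>

section \<open>Potentials on forests\<close>

text \<open>Induction on the edge set: delete an edge \<open>ab\<close> and solve the rest by
  \<open>p\<close>. If \<open>ab\<close> then fails, complement \<open>p\<close> on everything still
  reachable from \<open>a\<close>. No remaining edge leaves that set, and \<open>b\<close> lies
  outside it because \<open>ab\<close> is a bridge, so only the equation of \<open>ab\<close>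
  changes.\<close>

lemma potential_if_all_bridges:
  fixes E :: "('a \<times> 'a) set"
  assumes "finite E" "sym E"
    and "\<And>u v. (u, v) \<in> E \<Longrightarrow> (u, v) \<notin> (E - {(u, v), (v, u)})\<^sup>*"
    and L_sym: "\<And>u v. (u, v) \<in> E \<Longrightarrow> L u v = L v u"
  shows "\<exists>p :: 'a \<Rightarrow> bool. \<forall>(u, v) \<in> E. (p u \<noteq> p v) = L u v"
  using assms
proof (induction E rule: finite_psubset_induct)
  case (psubset E)
  show ?case
  proof (cases "E = {}")
    case False
    then obtain a b where ab: "(a, b) \<in> E"
      by auto
    define E' where "E' = E - {(a, b), (b, a)}"
    have "E' \<subset> E"
      using ab by (auto simp: E'_def)
    have symE': "sym E'"
      using psubset.prems(1) by (auto simp: E'_def sym_def)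
    have bridges: "(u, v) \<notin> (E' - {(u, v), (v, u)})\<^sup>*" if "(u, v) \<in> E'" for u v
    proof -
      have "(E' - {(u, v), (v, u)})\<^sup>* \<subseteq> (E - {(u, v), (v, u)})\<^sup>*"
        by (intro rtrancl_mono) (auto simp: E'_def)
      then show ?thesis
        using psubset.prems(2)[of u v] that by (auto simp: E'_def)
    qed
    have "L u v = L v u" if "(u, v) \<in> E'" for u v
      using psubset.prems(3)[of u v] that unfolding E'_def by blast
    from psubset.IH[OF \<open>E' \<subset> E\<close> symE' bridges this]
    obtain p :: "'a \<Rightarrow> bool" where p: "\<forall>(u, v) \<in> E'. (p u \<noteq> p v) = L u v"
      by blast
    have E: "E = E' \<union> {(a, b), (b, a)}"
      using ab psubset.prems(1) by (auto simp: E'_def sym_def)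
    show ?thesis
    proof (cases "(p a \<noteq> p b) = L a b")
      case True
      then have "\<forall>(u, v) \<in> E. (p u \<noteq> p v) = L u v"
        using p psubset.prems(3)[OF ab] unfolding E by auto
      then show ?thesis
        by blast
    next
      case False
      define q where "q v = (p v \<noteq> ((a, v) \<in> E'\<^sup>*))" for v
      have "((a, u) \<in> E'\<^sup>*) = ((a, v) \<in> E'\<^sup>*)" if "(u, v) \<in> E'" for u v
        using that symE' by (meson rtrancl.rtrancl_into_rtrancl symE)
      then have "(q u \<noteq> q v) = L u v" if "(u, v) \<in> E'" for u v
        using that p by (auto simp: q_def)
      moreover have "(a, b) \<notin> E'\<^sup>*"
        using psubset.prems(2)[OF ab] by (simp add: E'_def)
      then have "(q a \<noteq> q b) = L a b"
        using False by (auto simp: q_def)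
      ultimately have "\<forall>(u, v) \<in> E. (q u \<noteq> q v) = L u v"
        using psubset.prems(3)[OF ab] unfolding E by auto
      then show ?thesis
        by blast
    qed
  qed simp
qed

text \<open>A path from \<open>u\<close> to \<open>v\<close> avoiding the edge closes up with the
  arc \<open>(v, u)\<close> to a cycle of length at least 3 in the induced subgraph.\<close>

lemma undirected_forest_bridge:
  assumes "pair_graph G" "S \<subseteq> pverts G" "undirected_forest (with_proj G \<restriction> S)"
    and E_def: "E = {(u, v) \<in> parcs G. u \<in> S \<and> v \<in> S}"
    and uv: "(u, v) \<in> E"
  shows "(u, v) \<notin> (E - {(u, v), (v, u)})\<^sup>*"
proof
  assume reach: "(u, v) \<in> (E - {(u, v), (v, u)})\<^sup>*"
  interpret pair_graph G
    by fact
  define H where "H = \<lparr>pverts = S, parcs = E\<rparr>"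
  define H' where "H' = \<lparr>pverts = S, parcs = E - {(u, v), (v, u)}\<rparr>"
  interpret H: pair_wf_digraph H
    by unfold_locales (auto simp: H_def E_def)
  interpret H': pair_wf_digraph H'
    by unfold_locales (auto simp: H'_def E_def)
  have H_eq: "with_proj G \<restriction> S = with_proj H"
    by (auto simp: induce_subgraph_def with_proj_def H_def E_def)
  have "u \<noteq> v"
    using uv no_loops' by (auto simp: E_def)
  obtain p where p: "H'.apath u p v"
    using H'.reachable_conv'[of u v] H'.reachable_apath[of u v] reach uv by (auto simp: H'_def E_def)
  have arcs_p: "set p \<subseteq> E - {(u, v), (v, u)}" and cas_p: "pcas u p v"
    using p unfolding H'.apath_def H'.awalk_def by (simp_all add: H'_def)
  have "H.awalk v ((v, u) # p) v"
    using uv arcs_p cas_p arcs_symmetric unfolding H.awalk_def by (auto simp: H_def E_def)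
  moreover have "distinct (tl (pawalk_verts v ((v, u) # p)))"
    using p by (simp add: H'.apath_def)
  \<comment> \<open>The path is nonempty since \<open>u \<noteq> v\<close>, and it is not a single
    arc since \<open>(u, v)\<close> was removed.\<close>
  moreover have "3 \<le> length ((v, u) # p)"
  proof (cases p)
    case Nil
    then show ?thesis
      using cas_p \<open>u \<noteq> v\<close> by simp
  next
    case (Cons e es)
    then show ?thesis
      using cas_p arcs_p by (cases es; cases e) auto
  qed
  ultimately have "\<exists>p. H.cycle p \<and> 3 \<le> length p"
    unfolding H.cycle_def by blast
  then show False
    using assms(3) by (simp add: undirected_forest_def H_eq)
qed

text \<open>\<open>S\<close> is an arbitrary set, so that solutions for all colour pairs can be
  chosen at once; a set that no edge realises imposes no equation.\<close>

lemma colour_pair_potential: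
  fixes G :: "'a pair_pre_digraph"
  assumes "pair_graph G" "acyclic_colouring G k f"
    and L_sym: "\<And>u v. (u, v) \<in> parcs G \<Longrightarrow> L u v = L v u"
  shows "\<exists>p :: 'a \<Rightarrow> bool. \<forall>u v. (u, v) \<in> parcs G \<longrightarrow> {f u, f v} = S \<longrightarrow> (p u \<noteq> p v) = L u v"
proof (cases "\<exists>u v. (u, v) \<in> parcs G \<and> {f u, f v} = S")
  case True
  interpret pair_graph G
    by fact
  from True obtain u v where uv: "(u, v) \<in> parcs G" "S = {f u, f v}"
    by auto
  define T where "T = colour_class G f (f u) \<union> colour_class G f (f v)"
  define E where "E = {(u, v) \<in> parcs G. u \<in> T \<and> v \<in> T}"
  have "f u \<noteq> f v" "f u < k" "f v < k"
    using assms(2) uv in_arcsD1[OF uv(1)] in_arcsD2[OF uv(1)]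
    by (auto simp: acyclic_colouring_def proper_colouring_def)
  then have "undirected_forest (with_proj G \<restriction> T)"
    using assms(2) by (simp add: acyclic_colouring_def T_def)
  moreover have "T \<subseteq> pverts G"
    by (auto simp: T_def colour_class_def)
  ultimately have "(x, y) \<notin> (E - {(x, y), (y, x)})\<^sup>*" if "(x, y) \<in> E" for x y
    using undirected_forest_bridge[OF assms(1) _ _ E_def that] by blast
  moreover have "finite E"
    by (rule finite_subset[OF _ pair_finite_arcs]) (auto simp: E_def)
  moreover have "sym E"
    using arcs_symmetric by (auto simp: E_def sym_def)
  moreover have "L x y = L y x" if "(x, y) \<in> E" for x y
    using that L_sym[of x y] by (simp add: E_def)
  ultimately obtain p :: "'a \<Rightarrow> bool" where p: "\<forall>(x, y) \<in> E. (p x \<noteq> p y) = L x y"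
    using potential_if_all_bridges[of E L] by blast
  have potential: "(p x \<noteq> p y) = L x y" if xy: "(x, y) \<in> parcs G" "{f x, f y} = S" for x y
  proof -
    have "f x \<in> S" "f y \<in> S"
      using xy(2) by blast+
    then have "(x, y) \<in> E"
      using xy(1) in_arcsD1[OF xy(1)] in_arcsD2[OF xy(1)] uv(2)
      by (simp add: E_def T_def colour_class_def disj_commute)
    then show ?thesis
      using bspec[OF p, of "(x, y)"] by simp
  qed
  show ?thesis
    by (intro exI[of _ p] allI impI potential)
qed auto

section \<open>Inversions and parity\<close>

lemma pverts_invert [simp]: "pverts (invert X D) = pverts D"
  by (simp add: invert_def)

lemma parcs_invert_iff:
  "(u, v) \<in> parcs (invert X D) \<longleftrightarrow> (if u \<in> X \<and> v \<in> X then (v, u) else (u, v)) \<in> parcs D"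
  by (force simp: invert_def image_iff split: if_splits)

lemma pverts_fold_invert [simp]: "pverts (fold invert Xs D) = pverts D"
  by (induction Xs arbitrary: D) auto

text \<open>Each inversion acts on an edge independently of the other edges, so only the parity of
  the number of sets containing both endpoints matters.\<close>

lemma parcs_fold_invert_iff:
  "(u, v) \<in> parcs (fold invert Xs D) \<longleftrightarrow>
    (if odd (length (filter (\<lambda>X. u \<in> X \<and> v \<in> X) Xs)) then (v, u) else (u, v)) \<in> parcs D"
  by (induction Xs arbitrary: D) (auto simp: parcs_invert_iff)

lemma orientation_arc_iff:
  assumes "orientation G D" "(u, v) \<in> parcs G"
  shows "(u, v) \<in> parcs D \<longleftrightarrow> (v, u) \<notin> parcs D"
  using assms by (auto simp: orientation_def)

lemma inversion_distance_le:
  assumes "pair_graph G" "orientation G D" "orientation G D'"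
    and "\<forall>X \<in> set Xs. X \<subseteq> pverts G"
    and parity: "\<And>u v. (u, v) \<in> parcs G \<Longrightarrow>
      odd (length (filter (\<lambda>X. u \<in> X \<and> v \<in> X) Xs)) = (((u, v) \<in> parcs D) \<noteq> ((u, v) \<in> parcs D'))"
  shows "inversion_distance D D' \<le> length Xs"
proof -
  interpret pair_graph G
    by fact
  have "(u, v) \<in> parcs (fold invert Xs D) \<longleftrightarrow> (u, v) \<in> parcs D'" for u v
  proof (cases "(u, v) \<in> parcs G")
    case True
    then show ?thesis
      using orientation_arc_iff[OF assms(2) True] parity[OF True] by (auto simp: parcs_fold_invert_iff)
  next
    case False
    moreover have "(v, u) \<notin> parcs G"
      using False arcs_symmetric by blast
    ultimately show ?thesis
      using assms(2,3) by (auto simp: parcs_fold_invert_iff orientation_def)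
  qed
  then have "parcs (fold invert Xs D) = parcs D'"
    by auto
  then have "fold invert Xs D = D'"
    using assms(2,3) by (intro pair_pre_digraph.equality) (auto simp: orientation_def)
  then show ?thesis
    unfolding inversion_distance_def using assms(2,4)
    by (intro Least_le exI[of _ Xs]) (auto simp: orientation_def)
qed

lemma length_filter_map_upt:
  "length (filter P (map g [0..<n])) = card {l. l < n \<and> P (g l)}"
proof -
  have "length (filter (P \<circ> g) [0..<n]) = card (set (filter (P \<circ> g) [0..<n]))"
    by (simp only: distinct_card distinct_filter distinct_upt)
  then show ?thesis
    by (simp add: filter_map)
qed

section \<open>Distance bounds from an acyclic colouring\<close>

lemma inversion_distance_le_two_mult:
  fixes G :: "'a pair_pre_digraph"
  assumes "pair_graph G" "acyclic_colouring G (Suc m) f"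
    and D: "orientation G D" "orientation G D'"
  shows "inversion_distance D D' \<le> 2 * m + 1"
proof -
  interpret pair_graph G
    by fact
  define L where "L u v = (((u, v) \<in> parcs D) \<noteq> ((u, v) \<in> parcs D'))" for u v
  have L_sym: "L u v = L v u" if "(u, v) \<in> parcs G" for u v
    using D[THEN orientation_arc_iff, OF that] by (simp add: L_def)
  have "\<forall>S. \<exists>p :: 'a \<Rightarrow> bool. \<forall>u v. (u, v) \<in> parcs G \<longrightarrow> {f u, f v} = S \<longrightarrow>
      (p u \<noteq> p v) = L u v"
    by (intro allI colour_pair_potential[OF assms(1,2)] L_sym)
  from choice[OF this] obtain P :: "nat set \<Rightarrow> 'a \<Rightarrow> bool" where
    P: "\<forall>S u v. (u, v) \<in> parcs G \<longrightarrow> {f u, f v} = S \<longrightarrow> (P S u \<noteq> P S v) = L u v"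
    by (elim exE)
  \<comment> \<open>\<open>c v\<close> is the later bit \<open>b v m\<close>, which depends on
    \<open>P\<close> alone. Hence the error of the unpaired inversion \<open>A m\<close> is already
    fixed and can be built into the prescription \<open>M\<close> for the remaining colour
    pairs.\<close>
  define c where "c v = P {f v, m} v" for v
  define M where "M u v = (L u v \<noteq> (c u \<and> c v))" for u v
  have M_sym: "M u v = M v u" if "(u, v) \<in> parcs G" for u v
    using L_sym[OF that] by (auto simp: M_def)
  have "\<forall>S. \<exists>p :: 'a \<Rightarrow> bool. \<forall>u v. (u, v) \<in> parcs G \<longrightarrow> {f u, f v} = S \<longrightarrow>
      (p u \<noteq> p v) = M u v"
    by (intro allI colour_pair_potential[OF assms(1,2)] M_sym)
  from choice[OF this] obtain Q :: "nat set \<Rightarrow> 'a \<Rightarrow> bool" where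
    Q: "\<forall>S u v. (u, v) \<in> parcs G \<longrightarrow> {f u, f v} = S \<longrightarrow> (Q S u \<noteq> Q S v) = M u v"
    by (elim exE)
  define b where "b v i = (if m \<in> {f v, i} then P {f v, i} v else Q {f v, i} v)" for v i
  define A where "A i = {v \<in> pverts G. f v = i \<or> b v i}" for i
  define B where "B i = {v \<in> pverts G. f v \<noteq> i \<and> b v i}" for i
  let ?Xs = "map A [0..<Suc m] @ map B [0..<m]"
  have "inversion_distance D D' \<le> length ?Xs"
  proof (rule inversion_distance_le[OF assms(1) D])
    show "\<forall>X \<in> set ?Xs. X \<subseteq> pverts G"
      by (auto simp: A_def B_def)
    fix u v
    assume uv: "(u, v) \<in> parcs G"
    have verts: "u \<in> pverts G" "v \<in> pverts G"
      using uv in_arcsD1 in_arcsD2 by auto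
    have col: "f u \<noteq> f v" "f u < Suc m" "f v < Suc m"
      using assms(2) uv verts by (auto simp: acyclic_colouring_def proper_colouring_def)
    let ?SA = "{l. l < Suc m \<and> u \<in> A l \<and> v \<in> A l}" and ?SB = "{l. l < m \<and> u \<in> B l \<and> v \<in> B l}"
    have "?SB \<subseteq> ?SA"
      by (auto simp: A_def B_def)
    have "length (filter (\<lambda>X. u \<in> X \<and> v \<in> X) ?Xs) = card ?SA + card ?SB"
      by (simp only: filter_append length_append length_filter_map_upt)
    also have "\<dots> = card (?SA - ?SB) + 2 * card ?SB"
      using card_mono[OF _ \<open>?SB \<subseteq> ?SA\<close>] \<open>?SB \<subseteq> ?SA\<close> by (simp add: card_Diff_subset)
    \<comment> \<open>A vertex not coloured \<open>l\<close> lies in \<open>A l\<close> iff it lies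
      in \<open>B l\<close>. So for \<open>l < m\<close> the two counts differ only if
      \<open>l\<close> is \<open>f u\<close> or \<open>f v\<close>, and then the bit of the other
      endpoint decides. The index \<open>m\<close> has no partner \<open>B m\<close>, which gives
      the third set.\<close>
    also have "?SA - ?SB = (if b v (f u) then {f u} else {}) \<union> (if b u (f v) then {f v} else {}) \<union>
        (if m \<notin> {f u, f v} \<and> b u m \<and> b v m then {m} else {})"
      using col verts by (auto simp: A_def B_def less_Suc_eq)
    also have "odd (card \<dots> + 2 * card ?SB) =
        ((b v (f u) \<noteq> b u (f v)) \<noteq> (m \<notin> {f u, f v} \<and> b u m \<and> b v m))"
      using col by (auto simp: card_insert_if)
    also have "\<dots> = L u v"
    \<comment> \<open>If \<open>m\<close> is one of the two colours, both bits come from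
      \<open>P\<close>, which solves \<open>L\<close>, and there is no error term. Otherwise they
      come from \<open>Q\<close>, which solves \<open>M\<close>, and the error
      \<open>c u \<and> c v\<close> turns \<open>M\<close> back into \<open>L\<close>.\<close>
    proof -
      have "(P {f u, f v} u \<noteq> P {f u, f v} v) = L u v" "(Q {f u, f v} u \<noteq> Q {f u, f v} v) = M u v"
        using P[rule_format, OF uv refl] Q[rule_format, OF uv refl] by simp_all
      then show ?thesis
        by (auto simp: b_def M_def c_def insert_commute)
    qed
    finally show "odd (length (filter (\<lambda>X. u \<in> X \<and> v \<in> X) ?Xs)) =
        (((u, v) \<in> parcs D) \<noteq> ((u, v) \<in> parcs D'))"
      by (simp add: L_def)
  qed
  then show ?thesis
    by simp
qed

text \<open>Every edge joins colours 0 and 1, so one potential \<open>p\<close> serves all edges.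
  Both ends lie in \<open>A 0\<close> iff \<open>p\<close> holds at the end coloured 1, and in
  \<open>A 1\<close> iff it holds at the end coloured 0; the parity is
  \<open>p u \<noteq> p v\<close>.\<close>

lemma inversion_distance_le_two:
  fixes G :: "'a pair_pre_digraph"
  assumes "pair_graph G" "acyclic_colouring G k f" "k \<le> 2"
    and D: "orientation G D" "orientation G D'"
  shows "inversion_distance D D' \<le> 2"
proof -
  interpret pair_graph G
    by fact
  define L where "L u v = (((u, v) \<in> parcs D) \<noteq> ((u, v) \<in> parcs D'))" for u v
  have L_sym: "L u v = L v u" if "(u, v) \<in> parcs G" for u v
    using D[THEN orientation_arc_iff, OF that] by (simp add: L_def)
  have "\<exists>p :: 'a \<Rightarrow> bool. \<forall>u v. (u, v) \<in> parcs G \<longrightarrow> {f u, f v} = {0, 1} \<longrightarrow> (p u \<noteq> p v) = L u v"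
    by (intro colour_pair_potential[OF assms(1,2)] L_sym)
  then obtain p :: "'a \<Rightarrow> bool" where
    p: "\<forall>u v. (u, v) \<in> parcs G \<longrightarrow> {f u, f v} = {0, 1} \<longrightarrow> (p u \<noteq> p v) = L u v"
    by (elim exE)
  define A where "A i = {v \<in> pverts G. f v = i \<or> p v}" for i :: nat
  have "inversion_distance D D' \<le> length [A 0, A 1]"
  proof (rule inversion_distance_le[OF assms(1) D])
    show "\<forall>X \<in> set [A 0, A 1]. X \<subseteq> pverts G"
      by (auto simp: A_def)
    fix u v
    assume uv: "(u, v) \<in> parcs G"
    have verts: "u \<in> pverts G" "v \<in> pverts G"
      using uv in_arcsD1 in_arcsD2 by auto
    have "f u \<noteq> f v" "f u < k" "f v < k"
      using assms(2) uv verts by (auto simp: acyclic_colouring_def proper_colouring_def)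
    then have col: "(f u = 0 \<and> f v = 1) \<or> (f u = 1 \<and> f v = 0)"
      using assms(3) by linarith
    then have "{f u, f v} = {0, 1}"
      by auto
    then have "(p u \<noteq> p v) = L u v"
      by (intro p[rule_format, OF uv])
    then show "odd (length (filter (\<lambda>X. u \<in> X \<and> v \<in> X) [A 0, A 1])) =
        (((u, v) \<in> parcs D) \<noteq> ((u, v) \<in> parcs D'))"
      using col verts by (auto simp: A_def L_def)
  qed
  then show ?thesis
    by simp
qed

section \<open>From distances to the diameter\<close>

lemma orientation_exists:
  fixes G :: "'a pair_pre_digraph"
  assumes "pair_graph G"
  shows "\<exists>D. orientation G D"
proof -
  interpret pair_graph G
    by fact
  obtain h :: "'a \<Rightarrow> nat" where h: "inj_on h (pverts G)"
    using finite_imp_inj_to_nat_seg[OF pair_finite_verts] by blast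
  \<comment> \<open>Number the vertices injectively and direct each edge towards the larger
    number.\<close>
  have "orientation G \<lparr>pverts = pverts G, parcs = {(u, v) \<in> parcs G. h u < h v}\<rparr>"
    using h no_loops' arcs_symmetric in_arcsD1 in_arcsD2
    by (auto simp: orientation_def) (meson inj_onD linorder_neqE_nat)
  then show ?thesis ..
qed

lemma finite_orientations:
  assumes "pair_graph G"
  shows "finite {D. orientation G D}"
proof (rule finite_surj)
  interpret pair_graph G
    by fact
  show "finite (Pow (parcs G))"
    using pair_finite_arcs by simp
  show "{D. orientation G D} \<subseteq> (\<lambda>R. \<lparr>pverts = pverts G, parcs = R\<rparr>) ` Pow (parcs G)"
    by (auto simp: orientation_def image_iff intro!: bexI pair_pre_digraph.equality)
qed

lemma inversion_diameter_le:
  assumes "pair_graph G"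
    and "\<And>D D'. orientation G D \<Longrightarrow> orientation G D' \<Longrightarrow> inversion_distance D D' \<le> n"
  shows "inversion_diameter G \<le> n"
proof -
  let ?O = "{D. orientation G D}"
  have eq: "{inversion_distance D D' | D D'. orientation G D \<and> orientation G D'}
      = (\<lambda>(D, D'). inversion_distance D D') ` (?O \<times> ?O)"
    by auto
  \<comment> \<open>Bounding \<open>Max\<close> requires a finite nonempty set, hence finitely many
    orientations and at least one.\<close>
  show ?thesis
    unfolding inversion_diameter_def eq
    using assms finite_orientations[OF assms(1)] orientation_exists[OF assms(1)]
    by (intro Max.boundedI) auto
qed

section \<open>Acyclic and star colourings exist\<close>

lemma star_colouring_imp_acyclic_colouring: "star_colouring G k f \<Longrightarrow> acyclic_colouring G k f"
  by (auto simp: star_colouring_def acyclic_colouring_def star_forest_def)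

lemma induced_subgraph_with_projD:
  assumes "induced_subgraph C (with_proj G \<restriction> S)"
  shows "verts C \<subseteq> S" "arcs_ends C = {(u, v) \<in> parcs G. u \<in> verts C \<and> v \<in> verts C}"
  using assms
  by (auto simp: induced_subgraph_def subgraph_def compatible_def arcs_ends_conv image_iff)

lemma star_component_if_card_le_two:
  assumes "pair_graph G" "S \<subseteq> {a, b}" "C \<in> pre_digraph.sccs (with_proj G \<restriction> S)"
  shows "star C"
proof -
  interpret pair_graph G
    by fact
  have C: "induced_subgraph C (with_proj G \<restriction> S)" "strongly_connected C"
    using assms(3) by (auto simp: pre_digraph.sccs_def)
  note ind = induced_subgraph_with_projD[OF C(1)]
  interpret C: wf_digraph C
    using C(1) by (simp add: induced_subgraph_def subgraph_def)
  obtain c where c: "c \<in> verts C"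
    using C(2) by (auto simp: strongly_connected_def)
  obtain d where d: "verts C \<subseteq> {c, d}"
    using c ind(1) assms(2) by blast
  show ?thesis
  proof (cases "verts C = {c}")
    case True
    then show ?thesis
      using ind(2) no_loops' by (auto simp: star_def)
  next
    case False
    then have CD: "verts C = {c, d}" "c \<noteq> d"
      using c d by auto
    then have "c \<rightarrow>\<^sup>*\<^bsub>C\<^esub> d"
      using C(2) by (auto simp: strongly_connected_def)
    then obtain x where "(c, x) \<in> arcs_ends C"
      using CD(2) by (auto elim: C.converse_reachable_cases)
    \<comment> \<open>Without loops, the first arc of a path leaving \<open>c\<close> can only end
      in \<open>d\<close>.\<close>
    then have "(c, d) \<in> parcs G"
      using ind(2) CD no_loops' by auto
    then have "arcs_ends C = {(c, d), (d, c)}"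
      using ind(2) CD no_loops' arcs_symmetric by auto
    then show ?thesis
      unfolding star_def using CD by (intro bexI[of _ c]) auto
  qed
qed

lemma undirected_forest_if_card_le_two:
  assumes "pair_graph G" "S \<subseteq> {a, b}"
  shows "undirected_forest (with_proj G \<restriction> S)"
  unfolding undirected_forest_def
proof clarify
  fix p
  interpret pair_graph G
    by fact
  interpret H: wf_digraph "with_proj G \<restriction> S"
    by (rule wellformed_induce_subgraph)
  assume "H.cycle p" "3 \<le> length p"
  then obtain u where u: "H.awalk u p u" "distinct (tl (H.awalk_verts u p))"
    by (auto simp: H.cycle_def)
  have "set (H.awalk_verts u p) \<subseteq> S"
    using u(1) by (elim H.awalkE) simp
  then have "set (tl (H.awalk_verts u p)) \<subseteq> {a, b}"
    using assms(2) list.set_sel(2)[OF H.awalk_verts_non_Nil, of _ u p] by (meson subset_iff)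
  \<comment> \<open>The vertices of a cycle after its start are distinct and as many as its arcs, so
    two vertices cannot carry a cycle of length 3.\<close>
  then have "card (set (tl (H.awalk_verts u p))) \<le> card {a, b}"
    by (simp add: card_mono)
  then have "length p \<le> card {a, b}"
    using u(2) by (simp add: distinct_card H.length_awalk_verts)
  also have "\<dots> \<le> 2"
    by (simp add: card_insert_if)
  finally show False
    using \<open>3 \<le> length p\<close> by simp
qed

text \<open>An injective colouring works, since two of its classes hold at most two vertices. This
  makes the \<open>LEAST\<close> in both chromatic numbers an attained minimum.\<close>

lemma star_colouring_exists:
  fixes G :: "'a pair_pre_digraph"
  assumes "pair_graph G"
  shows "\<exists>k f. star_colouring G k f"
proof -
  interpret pair_graph G
    by fact
  obtain h :: "'a \<Rightarrow> nat" and n where h: "inj_on h (pverts G)" "h ` pverts G = {i. i < n}"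
    using finite_imp_inj_to_nat_seg[OF pair_finite_verts] by blast
  have "star_forest (with_proj G \<restriction> (colour_class G h i \<union> colour_class G h j))" for i j
  proof -
    have "colour_class G h i \<union> colour_class G h j
        \<subseteq> {inv_into (pverts G) h i, inv_into (pverts G) h j}"
      using h by (auto simp: colour_class_def)
    then show ?thesis
      unfolding star_forest_def
      by (intro conjI ballI undirected_forest_if_card_le_two[OF assms]
          star_component_if_card_le_two[OF assms])
  qed
  moreover have "h u \<noteq> h v" if "(u, v) \<in> parcs G" for u v
    using inj_onD[OF h(1), of u v] in_arcsD1[OF that] in_arcsD2[OF that] no_loops'[OF that] by blast
  then have "proper_colouring G n h"
    using h(2) by (auto simp: proper_colouring_def)
  ultimately have "star_colouring G n h"
    by (simp add: star_colouring_def)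
  then show ?thesis
    by blast
qed

section \<open>Comparison of the chromatic numbers and the final bound\<close>

lemma acyclic_chromatic_number_le_star_chromatic_number:
  assumes "pair_graph G"
  shows "acyclic_chromatic_number G \<le> star_chromatic_number G"
proof -
  have "\<exists>f. star_colouring G (star_chromatic_number G) f"
    unfolding star_chromatic_number_def using star_colouring_exists[OF assms] by (rule LeastI_ex)
  then have "\<exists>f. acyclic_colouring G (star_chromatic_number G) f"
    using star_colouring_imp_acyclic_colouring by blast
  then show ?thesis
    unfolding acyclic_chromatic_number_def by (rule Least_le)
qed

theorem theorem1p3:
  fixes G :: "'a pair_pre_digraph"
  assumes "pair_graph G"
  shows "int (inversion_diameter G) \<le> max (4 * int (acyclic_chromatic_number G) - 7) 2 \<and>
         max (4 * int (acyclic_chromatic_number G) - 7) 2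
           \<le> max (4 * int (star_chromatic_number G) - 7) 2"
proof
  define k where "k = acyclic_chromatic_number G"
  have "\<exists>k f. acyclic_colouring G k f"
    using star_colouring_exists[OF assms] star_colouring_imp_acyclic_colouring by blast
  then have "\<exists>f. acyclic_colouring G k f"
    unfolding k_def acyclic_chromatic_number_def by (rule LeastI_ex)
  then obtain f where f: "acyclic_colouring G k f"
    by blast
  \<comment> \<open>In the second branch \<open>k \<ge> 3\<close>, so the natural subtraction is
    exact and \<open>2 * k - 1 \<le> 4 * k - 7\<close>.\<close>
  have "inversion_diameter G \<le> (if k \<le> 2 then 2 else 2 * (k - 1) + 1)"
  proof (rule inversion_diameter_le[OF assms])
    fix D D'
    assume D: "orientation G D" "orientation G D'"
    show "inversion_distance D D' \<le> (if k \<le> 2 then 2 else 2 * (k - 1) + 1)"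
      using inversion_distance_le_two[OF assms f _ D]
        inversion_distance_le_two_mult[OF assms _ D, of "k - 1" f] f by simp
  qed
  then show "int (inversion_diameter G) \<le> max (4 * int (acyclic_chromatic_number G) - 7) 2"
    unfolding k_def[symmetric] by (auto split: if_splits)
  show "max (4 * int (acyclic_chromatic_number G) - 7) 2
      \<le> max (4 * int (star_chromatic_number G) - 7) 2"
    using acyclic_chromatic_number_le_star_chromatic_number[OF assms] by linarith
qed

end
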